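(* Define $a:\mathbb{Z}_{>0}\to\mathbb{Z}_{>0}$ by $a(1)=1$ and, for $n>1$, $a(n)=1+\sum_{m} a(m)$, where the sum runs over all proper divisors $m$ of $n$ (positive divisors $m$ of $n$ with $m<n$). Let $g(n)$ denote the number of ordered factorizations of $n$ into integers greater than one (i.e. the number of finite sequences $(f_1,\dots,f_r)$, $r\ge 1$, of integers $f_i>1$ with $f_1 f_2\cdots f_r=n$), and set $g(1)=1$. Then for every integer $n>1$, $$a(n)=2\,g(n).$$
   Context: $a(n)$ is called the number of recursive divisors of $n$. Equivalently, $g$ satisfies $g(1)=1$ and $g(n)=\sum_{m} g(m)$ over proper divisors $m$ of $n$ for $n>1$. *)

theory Defs
  imports Main
begin

definition proper_divisors :: "nat \<Rightarrow> nat set" where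
  "proper_divisors n = {m. m dvd n \<and> m < n}"

(* The type nat stands for the positive integers here; the value at 0 is irrelevant. *)
function recursive_divisors :: "nat \<Rightarrow> nat" where
  "recursive_divisors n =
     (if n = 0 then 0
      else if n = 1 then 1
      else 1 + (\<Sum>m\<in>proper_divisors n. recursive_divisors m))"
  by auto
termination
  by (relation "measure id") (auto simp: proper_divisors_def)

(* As a simp rule the unconditional recursion equation would loop. *)
declare recursive_divisors.simps [simp del]

definition ordered_factorizations :: "nat \<Rightarrow> nat list set" where
  "ordered_factorizations n = {fs. fs \<noteq> [] \<and> (\<forall>f\<in>set fs. f > 1) \<and> prod_list fs = n}"

definition num_ordered_factorizations :: "nat \<Rightarrow> nat" where
  "num_ordered_factorizations n = (if n = 1 then 1 else card (ordered_factorizations n))"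

(* The cardinality above is a genuine count: card is never applied to an infinite set. *)
lemma finite_ordered_factorizations: "finite (ordered_factorizations n)"
proof (rule finite_subset)
  have len: "length fs \<le> prod_list fs \<and> prod_list fs > 0" if "\<forall>f\<in>set fs. f > 1" for fs :: "nat list"
    using that
  proof (induction fs)
    case (Cons f fs)
    then have ih: "length fs \<le> prod_list fs" "prod_list fs > 0" by auto
    have "2 * prod_list fs \<le> f * prod_list fs" using Cons.prems by (intro mult_right_mono) auto
    with ih have "Suc (length fs) \<le> f * prod_list fs" "f * prod_list fs > 0" by linarith+
    then show ?case by simp
  qed simp
  have "f \<le> prod_list fs" if mem: "f \<in> set fs" and gt: "\<forall>f\<in>set fs. f > 1" for f and fs :: "nat list"
  proof -
    obtain us vs where "fs = us @ f # vs" using split_list[OF mem] by blast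
    then have "f dvd prod_list fs" by simp
    with len[OF gt] show ?thesis by (auto intro: dvd_imp_le)
  qed
  with len show "ordered_factorizations n \<subseteq> {fs. set fs \<subseteq> {..n} \<and> length fs \<le> n}"
    by (auto simp: ordered_factorizations_def)
  show "finite {fs. set fs \<subseteq> {..n} \<and> length fs \<le> n}"
    by (rule finite_lists_length_le) simp
qed

end

theory Submission imports Defs begin

text \<open>
  Splitting off the first factor \<open>n div m\<close> of an ordered factorization of \<open>n > 1\<close> leaves an
  ordered factorization of the proper divisor \<open>m\<close>, so \<open>g\<close> satisfies the recursion
  \<open>g n = (\<Sum>m. g m)\<close>. In \<open>a n = 1 + a 1 + (\<Sum>m > 1. a m)\<close> the first two terms
  are \<open>2 = 2 * g 1\<close>, so by induction \<open>2 * g\<close> satisfies the same recursion as \<open>a\<close>.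
\<close>

text \<open>Unlike \<^const>\<open>ordered_factorizations\<close>, the empty list is admitted here; this makes
  the convention \<open>g 1 = 1\<close> a genuine count.\<close>

definition factor_lists :: "nat \<Rightarrow> nat list set" where
  "factor_lists n = {fs. (\<forall>f\<in>set fs. f > 1) \<and> prod_list fs = n}"

lemma finite_factor_lists: "finite (factor_lists n)"
proof (rule finite_subset)
  show "factor_lists n \<subseteq> insert [] (ordered_factorizations n)"
    by (auto simp: factor_lists_def ordered_factorizations_def)
qed (simp add: finite_ordered_factorizations)

lemma factor_lists_1: "factor_lists 1 = {[]}"
proof -
  have "fs = []" if "fs \<in> factor_lists 1" for fs
    using that by (cases fs) (auto simp: factor_lists_def)
  then show ?thesis
    by (auto simp: factor_lists_def)
qed

lemma card_factor_lists: "card (factor_lists n) = num_ordered_factorizations n"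
proof (cases "n = 1")
  case True
  then show ?thesis
    using factor_lists_1 by (simp add: num_ordered_factorizations_def)
next
  case False
  then have "factor_lists n = ordered_factorizations n"
    by (auto simp: factor_lists_def ordered_factorizations_def)
  with False show ?thesis
    by (simp add: num_ordered_factorizations_def)
qed

lemma finite_proper_divisors: "finite (proper_divisors n)"
  by (simp add: proper_divisors_def)

text \<open>Indexing by the product \<open>m\<close> of the tail determines the head as
  \<open>n div m\<close>; the head exceeds 1 exactly because \<open>m < n\<close>.\<close>

lemma factor_lists_rec:
  assumes "n > 1"
  shows "factor_lists n = (\<Union>m\<in>proper_divisors n. (#) (n div m) ` factor_lists m)"
proof (intro equalityI subsetI)
  fix fs assume fs: "fs \<in> factor_lists n"
  with assms obtain f gs where [simp]: "fs = f # gs"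
    by (cases fs) (auto simp: factor_lists_def)
  from fs have f: "f > 1" and gs: "gs \<in> factor_lists (prod_list gs)" and n: "n = f * prod_list gs"
    by (auto simp: factor_lists_def)
  from assms n have "prod_list gs > 0"
    by (cases "prod_list gs") auto
  with f n have "prod_list gs \<in> proper_divisors n" "n div prod_list gs = f"
    by (auto simp: proper_divisors_def)
  with gs show "fs \<in> (\<Union>m\<in>proper_divisors n. (#) (n div m) ` factor_lists m)"
    by auto
next
  fix fs assume "fs \<in> (\<Union>m\<in>proper_divisors n. (#) (n div m) ` factor_lists m)"
  then obtain m gs where m: "m dvd n" "m < n" and gs: "gs \<in> factor_lists m"
    and fs: "fs = (n div m) # gs"
    by (auto simp: proper_divisors_def)
  from m obtain k where k: "n = m * k" by blast
  \<comment> \<open>\<open>k = 0\<close> or \<open>m = 0\<close> would give \<open>n = 0\<close>,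
    and \<open>k = 1\<close> would give \<open>m = n\<close>; each contradicts
    \<open>m < n\<close>.\<close>
  with m have "k > 1" "m > 0"
    by (cases k; cases "k - 1"; auto)+
  with k gs fs show "fs \<in> factor_lists n"
    by (auto simp: factor_lists_def)
qed

lemma num_ordered_factorizations_rec:
  assumes "n > 1"
  shows "num_ordered_factorizations n = (\<Sum>m\<in>proper_divisors n. num_ordered_factorizations m)"
proof -
  \<comment> \<open>The union is disjoint: the tail of a list in the part for \<open>m\<close> has
    product \<open>m\<close>.\<close>
  have "card (factor_lists n) = (\<Sum>m\<in>proper_divisors n. card ((#) (n div m) ` factor_lists m))"
    unfolding factor_lists_rec[OF assms]
    by (rule card_UN_disjoint)
      (simp_all add: finite_proper_divisors finite_factor_lists, auto simp: factor_lists_def)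
  also have "\<dots> = (\<Sum>m\<in>proper_divisors n. card (factor_lists m))"
    by (simp add: card_image)
  finally show ?thesis
    by (simp only: card_factor_lists)
qed

theorem theorem1:
  fixes n :: nat
  assumes "n > 1"
  shows "recursive_divisors n = 2 * num_ordered_factorizations n"
  using assms
proof (induction n rule: less_induct)
  case (less n)
  let ?D = "proper_divisors n"
  \<comment> \<open>The claim fails at 1, where the two sides are 1 and 2, so this term is split off
    before the induction hypothesis is applied.\<close>
  have one: "1 \<in> ?D"
    using less.prems by (simp add: proper_divisors_def)
  note split = sum.remove[OF finite_proper_divisors one]
  have IH: "recursive_divisors m = 2 * num_ordered_factorizations m" if "m \<in> ?D - {1}" for m
  proof (rule less.IH)
    show "m < n"
      using that by (simp add: proper_divisors_def)
    \<comment> \<open>\<open>m = 0\<close> is excluded since 0 divides only 0.\<close>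
    show "m > 1"
      using that less.prems by (cases m) (auto simp: proper_divisors_def)
  qed
  have "recursive_divisors n = 1 + (\<Sum>m\<in>?D. recursive_divisors m)"
    using less.prems by (subst recursive_divisors.simps) simp
  also have "\<dots> = 2 + (\<Sum>m\<in>?D - {1}. recursive_divisors m)"
    by (simp add: split recursive_divisors.simps[of "Suc 0"])
  also have "\<dots> = 2 * (1 + (\<Sum>m\<in>?D - {1}. num_ordered_factorizations m))"
    by (simp add: IH sum_distrib_left)
  also have "\<dots> = 2 * (\<Sum>m\<in>?D. num_ordered_factorizations m)"
    by (simp add: split num_ordered_factorizations_def[of "Suc 0"])
  also have "\<dots> = 2 * num_ordered_factorizations n"
    using num_ordered_factorizations_rec[OF less.prems] by simp
  finally show ?case .
qed

end
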